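(* The following identity of power series in $q$ holds: $$G_8(q)^2=\left(8\,G_8(q^2)+32\,G_8(q^2)^2\right)G_8(q)+\left(G_8(q^2)+4\,G_8(q^2)^2\right).$$
   Context: $G_8(q)=q\prod_{n\ge1}\frac{(1-q^{8n})^4(1-q^{2n})^2}{(1-q^{4n})^2(1-q^n)^4}$; equivalently, with $q=e^{2\pi i\tau}$, $\operatorname{Im}\tau>0$, and $\eta(\tau)=e^{\pi i\tau/12}\prod_{n\ge1}(1-e^{2\pi i n\tau})$ the Dedekind eta function, $G_8(q)=\frac{\eta^4(8\tau)\eta^2(2\tau)}{\eta^2(4\tau)\eta^4(\tau)}$. *)

theory Defs
  imports "HOL-Analysis.Analysis" "HOL-Computational_Algebra.Formal_Power_Series"
begin

(* Only used for n >= 1: the denominator then has constant coefficient 1, so this is the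
   genuine quotient in the ring of formal power series (G8_factor_mult below). *)
definition G8_factor :: "nat \<Rightarrow> complex fps" where
  "G8_factor n = ((1 - fps_X ^ (8 * n)) ^ 4 * (1 - fps_X ^ (2 * n)) ^ 2) /
                 ((1 - fps_X ^ (4 * n)) ^ 2 * (1 - fps_X ^ n) ^ 4)"

(* prodinf indexes from 0, hence Suc; the infinite product is taken in the X-adic metric on
   formal power series, where it converges (G8_has_prod below). *)
definition G8 :: "complex fps" where
  "G8 = fps_X * prodinf (\<lambda>n. G8_factor (Suc n))"

lemma G8_factor_mult:
  assumes "n > 0"
  shows "G8_factor n * ((1 - fps_X ^ (4 * n)) ^ 2 * (1 - fps_X ^ n) ^ 4) =
         (1 - fps_X ^ (8 * n)) ^ 4 * (1 - fps_X ^ (2 * n)) ^ 2"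
proof -
  have "is_unit ((1 - fps_X ^ (4 * n)) ^ 2 * (1 - fps_X ^ n) ^ 4 :: complex fps)"
    using assms by (simp add: fps_is_unit_iff fps_power_zeroth power_0_left)
  then show ?thesis
    unfolding G8_factor_def using unit_imp_dvd by (metis dvd_div_mult_self)
qed

lemma G8_factor_nth:
  assumes "n > 0" "k < n"
  shows "fps_nth (G8_factor n) k = (if k = 0 then 1 else 0)"
proof -
  let ?X = "fps_X :: complex fps"
  define D where "D = (1 - ?X ^ (4 * n)) ^ 2 * (1 - ?X ^ n) ^ 4"
  define N where "N = (1 - ?X ^ (8 * n)) ^ 4 * (1 - ?X ^ (2 * n)) ^ 2"
  have pow: "?X ^ n dvd (1 - ?X ^ (m * n)) ^ j - 1" if "m > 0" for m j
  proof -
    have "?X ^ n dvd ?X ^ (m * n)" using that by (intro le_imp_power_dvd) simp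
    moreover have "(1 - ?X ^ (m * n)) - 1 dvd (1 - ?X ^ (m * n)) ^ j - 1"
      unfolding power_diff_1_eq by (rule dvd_triv_left)
    moreover have "(1 - ?X ^ (m * n)) - 1 = - (?X ^ (m * n))" by simp
    ultimately show ?thesis by (metis dvd_trans dvd_minus_iff)
  qed
  have mult1: "?X ^ n dvd a * b - 1" if "?X ^ n dvd a - 1" "?X ^ n dvd b - 1" for a b
  proof -
    have "a * b - 1 = a * (b - 1) + (a - 1)" by (simp add: algebra_simps)
    then show ?thesis using that by (metis dvd_add dvd_mult)
  qed
  have "?X ^ n dvd N - 1" unfolding N_def by (rule mult1; rule pow) simp_all
  moreover have "?X ^ n dvd D - 1" unfolding D_def
    using pow[of 4 2] pow[of 1 4] by (intro mult1) (simp_all only: mult_1 zero_less_one zero_less_numeral simp_thms)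
  ultimately have "?X ^ n dvd (N - 1) - (D - 1)" by (rule dvd_diff)
  moreover have "(N - 1) - (D - 1) = (G8_factor n - 1) * D"
    using G8_factor_mult[OF assms(1)] by (simp add: N_def D_def algebra_simps)
  moreover have "is_unit D" unfolding D_def
    using assms(1) by (simp add: fps_is_unit_iff fps_power_zeroth power_0_left)
  ultimately have "?X ^ n dvd G8_factor n - 1" by (metis dvd_mult_unit_iff)
  then obtain c where "G8_factor n - 1 = ?X ^ n * c" by (elim dvdE)
  then have "fps_nth (G8_factor n - 1) k = 0"
    using assms(2) by (simp add: fps_X_power_mult_nth)
  then show ?thesis by (simp add: fps_one_nth split: if_splits)
qed

lemma G8_has_prod: "(\<lambda>n. G8_factor (Suc n)) has_prod prodinf (\<lambda>n. G8_factor (Suc n))"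
proof -
  let ?p = "\<lambda>N. \<Prod>i\<le>N. G8_factor (Suc i)"
  define P where "P = Abs_fps (\<lambda>n. fps_nth (?p n) n)"
  have nth_mult: "fps_nth (a * G8_factor (Suc (Suc N))) k = fps_nth a k" if "k \<le> N" for a N k
  proof -
    have "fps_nth (a * G8_factor (Suc (Suc N))) k =
        (\<Sum>i=0..k. fps_nth a i * (if k - i = 0 then 1 else 0))"
      unfolding fps_mult_nth using that by (intro sum.cong) (auto simp: G8_factor_nth)
    also have "\<dots> = (\<Sum>i=0..k. if i = k then fps_nth a i else 0)"
      by (intro sum.cong) auto
    finally show ?thesis by simp
  qed
  have stable: "fps_nth (?p N) k = fps_nth (?p k) k" if "k \<le> N" for N k
    using that by (induction N rule: dec_induct) (simp_all add: nth_mult)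
  have "?p \<longlonglongrightarrow> P"
  proof (rule tendsto_fpsI)
    fix n show "\<forall>\<^sub>F N in sequentially. fps_nth (?p N) n = fps_nth P n"
      using eventually_ge_at_top[of n] unfolding P_def fps_nth_Abs_fps
      by eventually_elim (rule stable)
  qed
  moreover have "P \<noteq> 0"
  proof -
    have "fps_nth P 0 = 1" by (simp add: P_def G8_factor_nth)
    then show ?thesis by auto
  qed
  ultimately have "raw_has_prod (\<lambda>n. G8_factor (Suc n)) 0 P" by (simp add: raw_has_prod_def)
  then have "(\<lambda>n. G8_factor (Suc n)) has_prod P" by (simp add: has_prod_def)
  then show ?thesis using has_prod_unique[of "\<lambda>n. G8_factor (Suc n)" P] by simp
qed

end

theory Submission
  imports Defs "HOL-Computational_Algebra.Formal_Laurent_Series"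
begin

text \<open>
  Write \<open>x = G8(q)\<close>, \<open>y = G8(q\<^sup>2)\<close>; the claim factors as \<open>x\<^sup>2 = y (1 + 4 y) (1 + 8 x)\<close>.  Put
  \<open>\<theta>\<^sub>3(q) = \<Sum>q^(k\<^sup>2)\<close>, the sum over all integers \<open>k\<close>, and \<open>\<theta>\<^sub>4(q) = \<theta>\<^sub>3(-q)\<close>.  Two classical
  facts say that passing from \<open>q\<close> to \<open>q\<^sup>2\<close> is one step of the arithmetic-geometric mean:

    \<open>2 \<theta>\<^sub>3(q\<^sup>2)\<^sup>2 = \<theta>\<^sub>3(q)\<^sup>2 + \<theta>\<^sub>4(q)\<^sup>2\<close>   and   \<open>\<theta>\<^sub>4(q\<^sup>2)\<^sup>2 = \<theta>\<^sub>3(q) \<theta>\<^sub>4(q)\<close>.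

  The third ingredient is \<open>\<theta>\<^sub>3\<^sup>2 - \<theta>\<^sub>4\<^sup>2 = 8 x \<theta>\<^sub>4\<^sup>2\<close>, that is, \<open>1 + 8 x = \<theta>\<^sub>3\<^sup>2 / \<theta>\<^sub>4\<^sup>2\<close>.  Reading it
  at \<open>q\<^sup>2\<close> and inserting the two means gives \<open>y = (\<theta>\<^sub>3 - \<theta>\<^sub>4)\<^sup>2 / (16 \<theta>\<^sub>3 \<theta>\<^sub>4)\<close>, hence
  \<open>1 + 4 y = (\<theta>\<^sub>3 + \<theta>\<^sub>4)\<^sup>2 / (4 \<theta>\<^sub>3 \<theta>\<^sub>4)\<close>, and both sides of the claim are
  \<open>(\<theta>\<^sub>3\<^sup>2 - \<theta>\<^sub>4\<^sup>2)\<^sup>2 / (64 \<theta>\<^sub>4^4)\<close>.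

  The arithmetic mean (\<open>theta_arithmetic_mean\<close>) counts representations as a sum of two squares.
  The geometric mean (\<open>theta_geometric_mean\<close>) is immediate once \<open>\<theta>\<^sub>4\<close> is known to be the infinite
  product \<open>\<Prod>(1 - q^n)\<^sup>2 / (1 - q^(2n))\<close>; this is a theorem of Gauss (\<open>gauss_theta4\<close>),
  which follows from an exact finite identity of the kind found by Shanks
  (\<open>gauss_finite_identity\<close>) by letting the number of factors grow.

  The third ingredient (\<open>theta_difference\<close>) relates a difference of theta squares to a product.
  Both sides solve the recursion \<open>f\<^sup>2 = 8 \<theta>\<^sub>3(q^4)\<^sup>2 f(q\<^sup>2)\<close>, the difference because of the two means
  and the product by cancellation of factors; a solution of the form \<open>8 q + ...\<close> is unique
  (\<open>fps_square_recursion_unique\<close>).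
\<close>

section \<open>Limits in the X-adic topology\<close>

lemma eventually_fps_nth_eq_upto:
  fixes a :: "'a :: group_add fps"
  assumes "(f \<longlongrightarrow> a) F"
  shows "eventually (\<lambda>x. \<forall>k\<le>n. fps_nth (f x) k = fps_nth a k) F"
  using eventually_compose_filterlim[OF eventually_fps_nth_eq_nhds_fps_strong assms] .

lemma tendsto_mult_fps:
  fixes a b :: "'a :: ring fps"
  assumes "(f \<longlongrightarrow> a) F" "(g \<longlongrightarrow> b) F"
  shows "((\<lambda>x. f x * g x) \<longlongrightarrow> a * b) F"
proof (rule tendsto_fpsI)
  fix n
  show "eventually (\<lambda>x. fps_nth (f x * g x) n = fps_nth (a * b) n) F"
    using eventually_fps_nth_eq_upto[OF assms(1), of n] eventually_fps_nth_eq_upto[OF assms(2), of n]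
    by eventually_elim (simp add: fps_mult_nth)
qed

lemma tendsto_power_fps:
  fixes a :: "'a :: ring_1 fps"
  assumes "(f \<longlongrightarrow> a) F"
  shows "((\<lambda>x. f x ^ n) \<longlongrightarrow> a ^ n) F"
  by (induction n) (auto intro: tendsto_mult_fps assms)

lemma tendsto_fps_compose:
  fixes a :: "'a :: ring_1 fps"
  assumes "(f \<longlongrightarrow> a) F"
  shows "((\<lambda>x. f x oo c) \<longlongrightarrow> (a oo c)) F"
proof (rule tendsto_fpsI)
  fix n
  show "eventually (\<lambda>x. fps_nth (f x oo c) n = fps_nth (a oo c) n) F"
    using eventually_fps_nth_eq_upto[OF assms(1), of n]
    by eventually_elim (simp add: fps_compose_nth)
qed

text \<open>
  The factor with index \<open>n\<close> is \<open>1\<close> modulo \<open>X^(n + 1)\<close>, so multiplying by it leaves the coefficients up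
  to \<open>n\<close> alone: coefficient \<open>k\<close> of the partial products is constant from \<open>N = k\<close> on.
\<close>

lemma prodinf_fps:
  fixes f :: "nat \<Rightarrow> complex fps"
  assumes "\<And>n k. k \<le> n \<Longrightarrow> fps_nth (f n) k = (if k = 0 then 1 else 0)"
  shows "(\<lambda>N. \<Prod>n<N. f n) \<longlonglongrightarrow> prodinf f" and "fps_nth (prodinf f) 0 = 1"
proof -
  let ?p = "\<lambda>N. \<Prod>n<N. f n"
  define P where "P = Abs_fps (\<lambda>k. fps_nth (?p k) k)"
  have nth_mult: "fps_nth (a * f N) k = fps_nth a k" if "k \<le> N" for a N k
  proof -
    have "fps_nth (a * f N) k = (\<Sum>i=0..k. if i = k then fps_nth a i else 0)"
      unfolding fps_mult_nth using that by (intro sum.cong) (auto simp: assms)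
    then show ?thesis by simp
  qed
  have stable: "fps_nth (?p N) k = fps_nth (?p k) k" if "k \<le> N" for N k
    using that by (induction N rule: dec_induct) (simp_all add: nth_mult)
  have lim: "?p \<longlonglongrightarrow> P"
  proof (rule tendsto_fpsI)
    fix k show "\<forall>\<^sub>F N in sequentially. fps_nth (?p N) k = fps_nth P k"
      using eventually_ge_at_top[of k] unfolding P_def fps_nth_Abs_fps
      by eventually_elim (rule stable)
  qed
  have P0: "fps_nth P 0 = 1" by (simp add: P_def)
  then have "P \<noteq> 0" by auto
  moreover have "(\<lambda>N. \<Prod>n\<le>N. f n) \<longlonglongrightarrow> P"
    using LIMSEQ_Suc[OF lim] by (simp only: lessThan_Suc_atMost)
  ultimately have "f has_prod P" by (simp add: has_prod_def raw_has_prod_def)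
  then have "prodinf f = P" by (metis has_prod_unique)
  with lim P0 show "?p \<longlonglongrightarrow> prodinf f" "fps_nth (prodinf f) 0 = 1" by simp_all
qed

section \<open>A finite form of Gauss' theorem\<close>

text \<open>
  Here \<open>u k\<close> stands for \<open>1 / (1 + x^k)\<close>.  On the left the terms with \<open>s > 0\<close> carry a factor \<open>x^(n + 1)\<close>,
  so modulo \<open>x^(n + 1)\<close> the identity says that \<open>\<Prod>(1 - x^k) / (1 + x^k)\<close> agrees with the theta sum on
  the right; letting \<open>n\<close> grow yields \<open>gauss_theta4\<close>.  The powers of \<open>x\<close> in these terms are chosen so that
  the change of the left side from \<open>n\<close> to \<open>n + 1\<close> telescopes over \<open>s\<close> and only the new square power
  survives.
\<close>

lemma gauss_finite_identity:
  fixes x :: "'a :: comm_ring_1" and u :: "nat \<Rightarrow> 'a"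
  assumes u: "\<And>k. (1 + x ^ k) * u k = 1"
  shows "(\<Sum>s\<le>n. (-1) ^ s * 2 * u s * (\<Prod>k\<in>{s<..n}. (1 - x ^ k) * u k) * x ^ (s * Suc n)) =
         1 + 2 * (\<Sum>s=1..n. (-1) ^ s * x ^ (s ^ 2))"
proof (induction n)
  case 0
  then show ?case using u[of 0] by simp
next
  case (Suc n)
  define P where "P s = (\<Prod>k\<in>{s<..n}. (1 - x ^ k) * u k)" for s
  define F where "F s = (-1) ^ s * 2 * u s * P s * x ^ (s * Suc n)" for s
  define F' where
    "F' s = (-1) ^ s * 2 * u s * (P s * ((1 - x ^ Suc n) * u (Suc n))) * x ^ (s * Suc (Suc n))" for s
  have P_Suc: "P s = (1 - x ^ Suc s) * u (Suc s) * P (Suc s)" if "s < n" for s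
  proof -
    have "{s<..n} = insert (Suc s) {Suc s<..n}" using that by auto
    then show ?thesis by (simp add: P_def)
  qed
  \<comment> \<open>The bracket is arranged in two parts: \<open>1 - x^s\<close> turns \<open>P s\<close> into \<open>P (s - 1)\<close>, while \<open>1 + x^s\<close>
    cancels \<open>u s\<close>.  The second part at \<open>s\<close> is then minus the first part at \<open>s + 1\<close>.\<close>
  have diff: "F' s - F s = (-1) ^ Suc s * 2 * u (Suc n) * u s * P s * x ^ (s * Suc n) *
      ((1 - x ^ s) + x ^ Suc n * (1 + x ^ s))" for s
  proof -
    have *: "F s = (-1) ^ s * 2 * u s * P s * x ^ (s * Suc n) * ((1 + x ^ Suc n) * u (Suc n))"
      by (simp only: F_def u mult_1_right)
    have x: "x ^ (s * Suc (Suc n)) = x ^ (s * Suc n) * x ^ s"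
      by (simp add: add_ac flip: power_add)
    show ?thesis
      unfolding * F'_def x by (simp add: algebra_simps)
  qed
  have tele: "(\<Sum>s\<le>m. F' s - F s) =
      (-1) ^ Suc m * 2 * u (Suc n) * P m * x ^ (Suc m * Suc n)" if "m \<le> n" for m
    using that
  proof (induction m)
    case 0
    have "(\<Sum>s\<le>0. F' s - F s) =
        (-1) ^ Suc 0 * 2 * u (Suc n) * P 0 * x ^ (Suc 0 * Suc n) * ((1 + x ^ 0) * u 0)"
      by (simp add: diff algebra_simps)
    then show ?case
      by (simp only: u mult_1_right)
  next
    case (Suc m)
    have "(\<Sum>s\<le>Suc m. F' s - F s) =
       (-1) ^ Suc m * 2 * u (Suc n) * P m * x ^ (Suc m * Suc n) + (F' (Suc m) - F (Suc m))"
      using Suc by simp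
    also have "F' (Suc m) - F (Suc m) =
        (-1) ^ Suc (Suc m) * 2 * u (Suc n) * x ^ (Suc m * Suc n) *
          ((1 - x ^ Suc m) * u (Suc m) * P (Suc m)) +
        (-1) ^ Suc (Suc m) * 2 * u (Suc n) * P (Suc m) * (x ^ (Suc m * Suc n) * x ^ Suc n) *
          ((1 + x ^ Suc m) * u (Suc m))"
      unfolding diff by (simp add: algebra_simps)
    also have "x ^ (Suc m * Suc n) * x ^ Suc n = x ^ (Suc (Suc m) * Suc n)"
      by (simp flip: power_add add: algebra_simps)
    also have "(1 - x ^ Suc m) * u (Suc m) * P (Suc m) = P m"
      using P_Suc[of m] Suc.prems by simp
    finally show ?case
      unfolding u by (simp add: algebra_simps)
  qed
  have "{s<..Suc n} = insert (Suc n) {s<..n}" if "s \<le> n" for s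
    using that by auto
  then have "(\<Sum>s\<le>Suc n. (-1) ^ s * 2 * u s * (\<Prod>k\<in>{s<..Suc n}. (1 - x ^ k) * u k) * x ^ (s * Suc (Suc n)))
    = (\<Sum>s\<le>n. F' s) + (-1) ^ Suc n * 2 * u (Suc n) * x ^ (Suc n * Suc (Suc n))"
    by (simp add: F'_def P_def mult.commute mult.left_commute)
  also have "(\<Sum>s\<le>n. F' s) = (\<Sum>s\<le>n. F s) + (\<Sum>s\<le>n. F' s - F s)"
    by (simp add: sum_subtractf)
  also have "(\<Sum>s\<le>n. F s) = 1 + 2 * (\<Sum>s=1..n. (-1) ^ s * x ^ (s ^ 2))"
    using Suc.IH by (simp add: F_def P_def)
  also have "(\<Sum>s\<le>n. F' s - F s) = (-1) ^ Suc n * 2 * u (Suc n) * x ^ (Suc n * Suc n)"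
    using tele[of n] by (simp add: P_def)
  also have "x ^ (Suc n * Suc (Suc n)) = x ^ (Suc n * Suc n) * x ^ Suc n"
    by (simp flip: power_add add: algebra_simps)
  finally have "(\<Sum>s\<le>Suc n. (-1) ^ s * 2 * u s * (\<Prod>k\<in>{s<..Suc n}. (1 - x ^ k) * u k) * x ^ (s * Suc (Suc n)))
    = 1 + 2 * (\<Sum>s=1..n. (-1) ^ s * x ^ (s ^ 2)) +
      (-1) ^ Suc n * 2 * x ^ (Suc n * Suc n) * ((1 + x ^ Suc n) * u (Suc n))"
    by (simp add: algebra_simps)
  then show ?case
    unfolding u by (simp add: algebra_simps power2_eq_square)
qed

section \<open>Euler products and their dissections\<close>

definition euler_fps :: "complex fps" where
  "euler_fps = prodinf (\<lambda>n. 1 - fps_X ^ Suc n)"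

definition odd_euler_fps :: "complex fps" where
  "odd_euler_fps = prodinf (\<lambda>n. 1 - fps_X ^ (2 * n + 1))"

lemma euler_fps_tendsto: "(\<lambda>N. \<Prod>n<N. (1 - fps_X ^ Suc n)) \<longlonglongrightarrow> euler_fps"
  and euler_fps_nth_0 [simp]: "fps_nth euler_fps 0 = 1"
  unfolding euler_fps_def by (rule prodinf_fps; auto simp: fps_X_power_nth simp del: power_Suc)+

lemma odd_euler_fps_tendsto: "(\<lambda>N. \<Prod>n<N. (1 - fps_X ^ (2 * n + 1))) \<longlonglongrightarrow> odd_euler_fps"
  unfolding odd_euler_fps_def by (rule prodinf_fps) (auto simp: fps_X_power_nth simp del: power_Suc)

lemma fps_X_power_oo_fps_X_power: "(fps_X :: complex fps) ^ n oo fps_X ^ m = fps_X ^ (m * n)" if "m > 0"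
  using that by (simp add: fps_compose_power[symmetric] power_mult zero_power)

lemma fps_oo_X_power_oo_X_power:
  fixes f :: "complex fps"
  assumes "m > 0" "n > 0"
  shows "(f oo fps_X ^ m) oo fps_X ^ n = f oo fps_X ^ (n * m)"
  using assms by (simp add: fps_compose_assoc[symmetric] fps_X_power_oo_fps_X_power zero_power)

lemma fps_oo_X2_oo_uminus_X:
  fixes f :: "complex fps"
  shows "(f oo fps_X ^ 2) oo (- fps_X) = f oo fps_X ^ 2"
  by (rule fps_ext) (auto simp: fps_compose_uminus' fps_nth_compose_X_power)

lemma euler_fps_oo_tendsto:
  assumes "m > 0"
  shows "(\<lambda>N. \<Prod>n<N. (1 - fps_X ^ (m * Suc n))) \<longlonglongrightarrow> (euler_fps oo fps_X ^ m)"
  using tendsto_fps_compose[OF euler_fps_tendsto, of "fps_X ^ m"] assms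
  by (simp add: fps_compose_prod_distrib fps_compose_sub_distrib fps_X_power_oo_fps_X_power
      zero_power del: power_Suc mult_Suc_right)

text \<open>
  The exponents split into even and odd ones.  Along even lengths the partial products split
  exactly, so the limit is taken along \<open>2 * N\<close>.
\<close>

lemma euler_fps_eq: "euler_fps = (euler_fps oo fps_X ^ 2) * odd_euler_fps"
proof (rule LIMSEQ_unique)
  show "(\<lambda>N. \<Prod>n<2 * N. (1 - fps_X ^ Suc n)) \<longlonglongrightarrow> euler_fps"
    by (rule filterlim_compose[OF euler_fps_tendsto]) (rule mult_nat_left_at_top, simp)
  have "(\<Prod>n<2 * N. (1 - fps_X ^ Suc n)) =
      (\<Prod>n<N. (1 - fps_X ^ (2 * Suc n))) * (\<Prod>n<N. (1 - (fps_X :: complex fps) ^ (2 * n + 1)))" for N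
    by (induction N) (simp_all add: mult_ac)
  then show "(\<lambda>N. \<Prod>n<2 * N. (1 - fps_X ^ Suc n)) \<longlonglongrightarrow> (euler_fps oo fps_X ^ 2) * odd_euler_fps"
    using tendsto_mult_fps[OF euler_fps_oo_tendsto[of 2] odd_euler_fps_tendsto] by simp
qed

text \<open>Factor by factor this is \<open>(1 - q^m) (1 + q^m) = 1 - q^(2m)\<close> for odd \<open>m\<close>.\<close>

lemma odd_euler_fps_mult:
  "odd_euler_fps * (odd_euler_fps oo (- fps_X)) = odd_euler_fps oo fps_X ^ 2"
proof (rule LIMSEQ_unique)
  let ?p = "\<lambda>N. \<Prod>n<N. (1 - (fps_X :: complex fps) ^ (2 * n + 1))"
  show "(\<lambda>N. ?p N oo fps_X ^ 2) \<longlonglongrightarrow> (odd_euler_fps oo fps_X ^ 2)"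
    by (rule tendsto_fps_compose odd_euler_fps_tendsto)+
  have "(1 - fps_X ^ (2 * n + 1)) * ((1 - fps_X ^ (2 * n + 1)) oo (- fps_X)) =
      (1 - (fps_X :: complex fps) ^ (2 * n + 1)) oo fps_X ^ 2" for n
  proof -
    have "(1 - (fps_X :: complex fps) ^ (2 * n + 1)) oo (- fps_X) = 1 + fps_X ^ (2 * n + 1)"
      by (simp add: fps_compose_sub_distrib fps_compose_power[symmetric] del: power_Suc)
    moreover have "(1 - (fps_X :: complex fps) ^ (2 * n + 1)) oo fps_X ^ 2 = 1 - (fps_X ^ (2 * n + 1)) ^ 2"
      by (simp add: fps_compose_sub_distrib fps_X_power_oo_fps_X_power power_mult[symmetric] mult.commute
          del: power_Suc)
    ultimately show ?thesis by (simp add: algebra_simps power2_eq_square)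
  qed
  then have "?p N * (?p N oo (- fps_X)) = ?p N oo fps_X ^ 2" for N
    by (simp add: fps_compose_prod_distrib flip: prod.distrib)
  then show "(\<lambda>N. ?p N oo fps_X ^ 2) \<longlonglongrightarrow> odd_euler_fps * (odd_euler_fps oo (- fps_X))"
    using tendsto_mult_fps[OF odd_euler_fps_tendsto
        tendsto_fps_compose[OF odd_euler_fps_tendsto, of "- fps_X"]]
    by (simp only:)
qed

text \<open>
  This is the eta quotient with denominators cleared; the powers of \<open>q\<close> contributed by the eta functions
  combine to the single factor \<open>fps_X\<close>.  The coefficients serve as initial data in
  \<open>theta_difference\<close>.
\<close>

lemma G8_mult_euler_fps:
  "G8 * (euler_fps oo fps_X ^ 4) ^ 2 * euler_fps ^ 4 =
   fps_X * (euler_fps oo fps_X ^ 8) ^ 4 * (euler_fps oo fps_X ^ 2) ^ 2"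
  "fps_nth G8 0 = 0" "fps_nth G8 1 = 1"
proof -
  let ?P = "prodinf (\<lambda>n. G8_factor (Suc n))"
  let ?e = "\<lambda>m N. \<Prod>n<N. (1 - (fps_X :: complex fps) ^ (m * Suc n))"
  have G: "(\<lambda>N. \<Prod>n<N. G8_factor (Suc n)) \<longlonglongrightarrow> ?P" "fps_nth ?P 0 = 1"
    by (rule prodinf_fps; simp add: G8_factor_nth)+
  have "(\<Prod>n<N. G8_factor (Suc n)) * (?e 4 N ^ 2 * ?e 1 N ^ 4) = ?e 8 N ^ 4 * ?e 2 N ^ 2" for N
    using G8_factor_mult[OF zero_less_Suc]
    by (simp only: prod_power_distrib prod.distrib[symmetric] mult_1)
  then have *: "(\<lambda>N. ?e 8 N ^ 4 * ?e 2 N ^ 2) \<longlonglongrightarrow> ?P * ((euler_fps oo fps_X ^ 4) ^ 2 * euler_fps ^ 4)"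
    using tendsto_mult_fps[OF G(1) tendsto_mult_fps[OF
        tendsto_power_fps[OF euler_fps_oo_tendsto[of 4], of 2]
        tendsto_power_fps[OF euler_fps_oo_tendsto[of 1], of 4]]]
    by (simp del: power_Suc mult_Suc_right)
  have "?P * ((euler_fps oo fps_X ^ 4) ^ 2 * euler_fps ^ 4) =
      (euler_fps oo fps_X ^ 8) ^ 4 * (euler_fps oo fps_X ^ 2) ^ 2"
    by (rule LIMSEQ_unique[OF *]) (intro tendsto_mult_fps tendsto_power_fps euler_fps_oo_tendsto; simp)
  then show "G8 * (euler_fps oo fps_X ^ 4) ^ 2 * euler_fps ^ 4 =
   fps_X * (euler_fps oo fps_X ^ 8) ^ 4 * (euler_fps oo fps_X ^ 2) ^ 2"
    by (simp add: G8_def mult.assoc)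
  show "fps_nth G8 0 = 0" "fps_nth G8 1 = 1"
    using G(2) by (simp_all add: G8_def)
qed

section \<open>The theta series and Gauss' product\<close>

text \<open>
  The series \<open>\<Sum>q^(k\<^sup>2)\<close> over all integers, with its coefficients written as numbers of square
  roots so that the coefficients of its square count lattice points.
\<close>

definition theta3_fps :: "complex fps" where
  "theta3_fps = Abs_fps (\<lambda>n. of_nat (card {k :: int. k ^ 2 = int n}))"

definition theta4_fps :: "complex fps" where
  "theta4_fps = theta3_fps oo (- fps_X)"

lemma finite_sqrt_int: "finite {k :: int. k ^ 2 = int n}"
proof (rule finite_subset)
  show "{k :: int. k ^ 2 = int n} \<subseteq> {- int n..int n}"
  proof safe
    fix k :: int assume "k ^ 2 = int n"
    moreover have "\<bar>k\<bar> \<le> k ^ 2" 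
      using self_le_power[of "\<bar>k\<bar>" 2] by (cases "k = 0") auto
    ultimately show "k \<in> {- int n..int n}" by auto
  qed
qed simp

lemma theta3_tendsto: "(\<lambda>N. 1 + 2 * (\<Sum>s=1..N. fps_X ^ (s ^ 2))) \<longlonglongrightarrow> theta3_fps"
proof (rule tendsto_fpsI)
  fix n
  have "fps_nth (1 + 2 * (\<Sum>s=1..N. fps_X ^ (s ^ 2))) n = fps_nth theta3_fps n" if "n \<le> N" for N
  proof (cases "\<exists>m::nat. n = m ^ 2")
    case True
    then obtain m where m: "n = m ^ 2" by blast
    have roots: "{k :: int. k ^ 2 = int n} = {int m, - int m}"
      by (auto simp: m power2_eq_iff)
    have "m \<le> n" unfolding m by (simp add: power2_eq_square)
    then have "(\<Sum>s=1..N. fps_nth (fps_X ^ (s ^ 2)) n) = (if m = 0 then 0 else 1 :: complex)"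
      using that by (simp add: fps_X_power_nth m cong: if_cong)
    moreover have "card {k :: int. k ^ 2 = int n} = (if m = 0 then 1 else 2)"
      unfolding roots by simp
    ultimately show ?thesis
      by (simp add: theta3_fps_def fps_sum_nth fps_one_nth numeral_fps_const m)
  next
    case False
    have "{k :: int. k ^ 2 = int n} = {}"
    proof -
      have "n = nat \<bar>k\<bar> ^ 2" if "k ^ 2 = int n" for k :: int
        using that by (metis nat_int nat_power_eq power2_abs abs_ge_zero)
      then show ?thesis using False by auto
    qed
    moreover have "n \<noteq> 0" using False by (metis zero_power2)
    ultimately show ?thesis using False
      by (simp add: theta3_fps_def fps_sum_nth fps_X_power_nth)
  qed
  then show "\<forall>\<^sub>F N in sequentially.
      fps_nth (1 + 2 * (\<Sum>s=1..N. fps_X ^ (s ^ 2))) n = fps_nth theta3_fps n"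
    by (rule eventually_mono[OF eventually_ge_at_top[of n]])
qed

lemma theta4_tendsto:
  "(\<lambda>N. 1 + 2 * (\<Sum>s=1..N. (-1) ^ s * fps_X ^ (s ^ 2))) \<longlonglongrightarrow> theta4_fps"
proof -
  have "fps_X ^ (s ^ 2) oo (- fps_X) = (-1) ^ s * (fps_X ^ (s ^ 2) :: complex fps)" for s :: nat
    by (simp add: fps_compose_power[symmetric] power_minus[of fps_X] minus_one_power_iff)
  then show ?thesis
    using tendsto_fps_compose[OF theta3_tendsto, of "- fps_X"]
    by (simp add: theta4_fps_def fps_compose_add_distrib fps_compose_mult_distrib fps_compose_sum_distrib)
qed

text \<open>
  The partial products of \<open>(1 - X^k) / (1 + X^k)\<close> converge to \<open>\<theta>\<^sub>4\<close> by the finite identity, and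
  multiplying them by \<open>\<Prod>(1 - X^(2k)) = \<Prod>(1 - X^k) (1 + X^k)\<close> gives \<open>\<Prod>(1 - X^k)\<^sup>2\<close>.
\<close>

lemma gauss_theta4: "(euler_fps oo fps_X ^ 2) * theta4_fps = euler_fps ^ 2"
proof -
  define u where "u k = inverse (1 + fps_X ^ k :: complex fps)" for k
  have u: "(1 + fps_X ^ k) * u k = 1" for k
    unfolding u_def by (rule inverse_mult_eq_1') (simp add: fps_X_power_nth)
  define p where "p N = (\<Prod>n<N. (1 - fps_X ^ Suc n) * u (Suc n))" for N
  have p: "p \<longlonglongrightarrow> theta4_fps"
  proof (rule tendsto_fpsI)
    fix n
    let ?S = "\<lambda>N. 1 + 2 * (\<Sum>s=1..N. (-1) ^ s * fps_X ^ (s ^ 2)) :: complex fps"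
    have eq: "fps_nth (?S N) n = fps_nth (p N) n" if "n \<le> N" for N
    proof -
      let ?t = "\<lambda>s. (-1) ^ s * 2 * u s * (\<Prod>k\<in>{s<..N}. (1 - fps_X ^ k) * u k)"
      have p_eq: "(\<Prod>k\<in>{0<..N}. (1 - fps_X ^ k) * u k) = p N"
        unfolding p_def
        by (rule prod.reindex_bij_witness[of _ Suc "\<lambda>k. k - 1"]) auto
      have "?S N = (\<Sum>s\<le>N. ?t s * fps_X ^ (s * Suc N))"
        by (rule gauss_finite_identity[symmetric]) (rule u)
      also have "\<dots> = 2 * u 0 * p N + (\<Sum>s\<in>{1..N}. ?t s * fps_X ^ (s * Suc N))"
        by (subst sum.remove[of _ 0])
           (auto simp: p_eq intro!: sum.cong)
      \<comment> \<open>The term at \<open>s = 0\<close> has coefficient \<open>2 / (1 + X^0) = 1\<close>.\<close>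
      also have "2 * u 0 = 1" using u[of 0] by simp
      also have "(\<Sum>s\<in>{1..N}. fps_nth (?t s * fps_X ^ (s * Suc N)) n) = 0"
      proof (rule sum.neutral, rule ballI)
        fix s assume "s \<in> {1..N}"
        then have "n < s * Suc N" using that by (cases s) auto
        then show "fps_nth (?t s * fps_X ^ (s * Suc N)) n = 0"
          by (simp add: fps_X_power_mult_right_nth del: mult_Suc_right)
      qed
      then have "fps_nth (1 * p N + (\<Sum>s\<in>{1..N}. ?t s * fps_X ^ (s * Suc N))) n = fps_nth (p N) n"
        by (simp add: fps_sum_nth)
      finally show ?thesis .
    qed
    have "\<forall>\<^sub>F N in sequentially. fps_nth (?S N) n = fps_nth theta4_fps n"
      using theta4_tendsto unfolding tendsto_fps_iff by blast
    then show "\<forall>\<^sub>F N in sequentially. fps_nth (p N) n = fps_nth theta4_fps n"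
      using eventually_ge_at_top[of n]
    proof eventually_elim
      case (elim N)
      then show ?case using eq[of N] by metis
    qed
  qed
  have "(\<Prod>n<N. (1 - fps_X ^ (2 * Suc n))) * p N = (\<Prod>n<N. (1 - fps_X ^ Suc n)) ^ 2" for N
  proof -
    have "(1 - fps_X ^ (2 * Suc n)) * ((1 - fps_X ^ Suc n) * u (Suc n)) = (1 - fps_X ^ Suc n) ^ 2" for n
    proof -
      have "(1 - fps_X ^ (2 * Suc n)) * ((1 - fps_X ^ Suc n) * u (Suc n)) =
        (1 - fps_X ^ Suc n) ^ 2 * ((1 + fps_X ^ Suc n) * u (Suc n))"
        unfolding mult.commute[of 2] power_mult by algebra
      then show ?thesis by (simp only: u mult_1_right)
    qed
    then show ?thesis
      unfolding p_def by (simp only: prod.distrib[symmetric] prod_power_distrib)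
  qed
  then have "(\<lambda>N. (\<Prod>n<N. (1 - fps_X ^ Suc n)) ^ 2) \<longlonglongrightarrow> (euler_fps oo fps_X ^ 2) * theta4_fps"
    using tendsto_mult_fps[OF euler_fps_oo_tendsto[of 2] p] by simp
  then show ?thesis
    using tendsto_power_fps[OF euler_fps_tendsto, of 2] LIMSEQ_unique by blast
qed

section \<open>The two means\<close>

lemma fps_nth_theta3_square:
  "fps_nth (theta3_fps ^ 2) n = of_nat (card {(k :: int, l :: int). k ^ 2 + l ^ 2 = int n})"
proof -
  let ?A = "\<lambda>i. {k :: int. k ^ 2 = int i}"
  have "fps_nth (theta3_fps ^ 2) n = of_nat (\<Sum>i=0..n. card (?A i \<times> ?A (n - i)))"
    by (simp add: theta3_fps_def power2_eq_square fps_mult_nth card_cartesian_product)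
  also have "(\<Sum>i=0..n. card (?A i \<times> ?A (n - i))) = card (SIGMA i:{0..n}. ?A i \<times> ?A (n - i))"
    by (rule card_SigmaI[symmetric]) (auto intro!: finite_cartesian_product finite_sqrt_int simp del: of_nat_diff)
  also have "\<dots> = card {(k :: int, l :: int). k ^ 2 + l ^ 2 = int n}"
  proof (rule bij_betw_same_card)
    show "bij_betw snd (SIGMA i:{0..n}. ?A i \<times> ?A (n - i)) {(k, l). k ^ 2 + l ^ 2 = int n}"
    proof (rule bij_betw_byWitness[where f' = "\<lambda>(k, l). (nat (k ^ 2), k, l)"])
      have "nat (k ^ 2) \<le> n" if "k ^ 2 + l ^ 2 = int n" for k l :: int
        using that zero_le_power2[of l] by linarith
      moreover have "l ^ 2 = int (n - nat (k ^ 2))" if "k ^ 2 + l ^ 2 = int n" for k l :: int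
        using that zero_le_power2[of l] zero_le_power2[of k] by linarith
      ultimately show "(\<lambda>(k, l). (nat (k ^ 2), k, l)) ` {(k, l). k ^ 2 + l ^ 2 = int n}
          \<subseteq> (SIGMA i:{0..n}. ?A i \<times> ?A (n - i))"
        by auto
    qed auto
  qed
  finally show ?thesis .
qed

text \<open>
  Rotation by 45 degrees with scaling, \<open>(k, l) \<mapsto> (k + l, k - l)\<close>, doubles \<open>k\<^sup>2 + l\<^sup>2\<close>.  It is onto because a
  pair with even sum of squares has entries of equal parity.
\<close>

lemma card_two_squares_double:
  "card {(k :: int, l :: int). k ^ 2 + l ^ 2 = 2 * n} =
   card {(k :: int, l :: int). k ^ 2 + l ^ 2 = n}"
proof -
  let ?f = "\<lambda>(k :: int, l :: int). (k + l, k - l)"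
  let ?g = "\<lambda>(k :: int, l :: int). ((k + l) div 2, (k - l) div 2)"
  have *: "\<exists>a b. p = (a + b, a - b) \<and> a ^ 2 + b ^ 2 = n"
    if "p \<in> {(k, l). k ^ 2 + l ^ 2 = 2 * n}" for p
  proof -
    obtain k l where p: "p = (k, l)" and kl: "k ^ 2 + l ^ 2 = 2 * n"
      using \<open>p \<in> _\<close> by blast
    from kl have "even (k ^ 2 + l ^ 2)" by simp
    then have "even (k + l)" by simp
    then obtain a where "k + l = 2 * a" by blast
    then have l: "l = 2 * a - k" by simp
    have "2 * (a ^ 2 + (k - a) ^ 2) = 2 * n"
      unfolding kl[symmetric] l by (simp add: power2_eq_square algebra_simps)
    then show ?thesis
      unfolding p l by (intro exI[of _ a] exI[of _ "k - a"]) simp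
  qed
  have "bij_betw ?f {(k, l). k ^ 2 + l ^ 2 = n} {(k, l). k ^ 2 + l ^ 2 = 2 * n}"
  proof (rule bij_betw_byWitness[where f' = ?g])
    show "?f ` {(k, l). k ^ 2 + l ^ 2 = n} \<subseteq> {(k, l). k ^ 2 + l ^ 2 = 2 * n}"
      by (auto simp: power2_eq_square algebra_simps)
    show "\<forall>p\<in>{(k, l). k ^ 2 + l ^ 2 = 2 * n}. ?f (?g p) = p"
      using * by fastforce
    show "?g ` {(k, l). k ^ 2 + l ^ 2 = 2 * n} \<subseteq> {(k, l). k ^ 2 + l ^ 2 = n}"
      using * by fastforce
  qed auto
  then show ?thesis by (rule bij_betw_same_card[symmetric])
qed

text \<open>
  Replacing \<open>q\<close> by \<open>-q\<close> negates the odd coefficients, so on the left they cancel and the even ones double.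
\<close>

lemma theta_arithmetic_mean:
  "theta3_fps ^ 2 + theta4_fps ^ 2 = 2 * (theta3_fps oo fps_X ^ 2) ^ 2"
proof (rule fps_ext)
  fix n
  have "fps_nth (theta3_fps ^ 2) n = fps_nth (theta3_fps ^ 2) (n div 2)" if "even n"
  proof -
    have "int n = 2 * int (n div 2)" using that by auto
    then show ?thesis
      by (simp only: fps_nth_theta3_square card_two_squares_double)
  qed
  moreover have "theta4_fps ^ 2 = theta3_fps ^ 2 oo (- fps_X)"
    "(theta3_fps oo fps_X ^ 2) ^ 2 = theta3_fps ^ 2 oo fps_X ^ 2"
    by (simp_all add: theta4_fps_def fps_compose_power)
  ultimately show "fps_nth (theta3_fps ^ 2 + theta4_fps ^ 2) n =
      fps_nth (2 * (theta3_fps oo fps_X ^ 2) ^ 2) n"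
    by (cases "even n")
       (simp_all add: fps_compose_uminus' fps_nth_compose_X_power numeral_fps_const)
qed

lemma theta3_mult_euler: "theta3_fps = (euler_fps oo fps_X ^ 2) * (odd_euler_fps oo (- fps_X)) ^ 2"
  and theta4_mult_euler: "theta4_fps = (euler_fps oo fps_X ^ 2) * odd_euler_fps ^ 2"
proof -
  have "euler_fps oo fps_X ^ 2 \<noteq> 0"
    by (metis euler_fps_nth_0 fps_compose_nth_0 fps_zero_nth zero_neq_one)
  moreover have "(euler_fps oo fps_X ^ 2) * theta4_fps =
      (euler_fps oo fps_X ^ 2) * ((euler_fps oo fps_X ^ 2) * odd_euler_fps ^ 2)"
    unfolding gauss_theta4 by (subst euler_fps_eq) algebra
  ultimately show *: "theta4_fps = (euler_fps oo fps_X ^ 2) * odd_euler_fps ^ 2"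
    by simp
  have "theta3_fps = theta4_fps oo (- fps_X)"
    by (rule fps_ext) (simp add: theta4_fps_def fps_compose_uminus' flip: power_add)
  also have "\<dots> = (euler_fps oo fps_X ^ 2) * (odd_euler_fps oo (- fps_X)) ^ 2"
    unfolding * by (simp add: fps_compose_mult_distrib fps_compose_power fps_oo_X2_oo_uminus_X)
  finally show "theta3_fps = \<dots>" .
qed

text \<open>
  With \<open>E\<close> the Euler product and \<open>O\<close> its odd part, the left side is
  \<open>E(q\<^sup>2)\<^sup>2 (O(q) O(-q))\<^sup>2 = E(q\<^sup>2)\<^sup>2 O(q\<^sup>2)\<^sup>2\<close>, and the right side is \<open>E(q^4)\<^sup>2 O(q\<^sup>2)^4\<close>; these agree because
  \<open>E(q\<^sup>2) = E(q^4) O(q\<^sup>2)\<close>.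
\<close>

lemma theta_geometric_mean: "theta3_fps * theta4_fps = (theta4_fps oo fps_X ^ 2) ^ 2"
proof -
  have e2: "euler_fps oo fps_X ^ 2 = (euler_fps oo fps_X ^ 4) * (odd_euler_fps oo fps_X ^ 2)"
    by (subst euler_fps_eq) (simp add: fps_compose_mult_distrib fps_oo_X_power_oo_X_power)
  have "theta4_fps oo fps_X ^ 2 = (euler_fps oo fps_X ^ 4) * (odd_euler_fps oo fps_X ^ 2) ^ 2"
    unfolding theta4_mult_euler
    by (simp add: fps_compose_mult_distrib fps_oo_X_power_oo_X_power fps_compose_power)
  then show ?thesis
    unfolding theta3_mult_euler theta4_mult_euler
    using odd_euler_fps_mult e2 by algebra
qed

text \<open>The classical product for \<open>\<theta>\<^sub>3\<close>, free of products in \<open>-q\<close>.\<close>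

lemma theta3_euler_quotient:
  "theta3_fps * euler_fps ^ 2 * (euler_fps oo fps_X ^ 4) ^ 2 = (euler_fps oo fps_X ^ 2) ^ 5"
proof -
  have e2: "euler_fps oo fps_X ^ 2 = (euler_fps oo fps_X ^ 4) * (odd_euler_fps oo fps_X ^ 2)"
    by (subst euler_fps_eq) (simp add: fps_compose_mult_distrib fps_oo_X_power_oo_X_power)
  show ?thesis
    using theta3_mult_euler euler_fps_eq odd_euler_fps_mult e2 by algebra
qed

section \<open>The difference of the theta squares\<close>

text \<open>
  Let \<open>h = f - g\<close>.  Subtracting the recursions gives \<open>h (f + g) = c h(q\<^sup>2)\<close>, where \<open>f + g\<close> has order \<open>1\<close> and
  \<open>c\<close> is a unit.  If \<open>h\<close> has order \<open>k\<close>, then the left side has order \<open>k + 1\<close> and the right side order \<open>2 k\<close>, so \<open>k = 1\<close>; but agreement of the first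
  two coefficients forces \<open>k \<ge> 2\<close>.
\<close>

lemma fps_square_recursion_unique:
  fixes f g c :: "complex fps"
  assumes f: "f ^ 2 = c * (f oo fps_X ^ 2)" and g: "g ^ 2 = c * (g oo fps_X ^ 2)"
    and c0: "fps_nth c 0 \<noteq> 0"
    and f0: "fps_nth f 0 = 0" and g0: "fps_nth g 0 = 0"
    and fg1: "fps_nth f 1 = fps_nth g 1" and g1: "fps_nth g 1 \<noteq> 0"
  shows "f = g"
proof (rule ccontr)
  assume "f \<noteq> g"
  define h where "h = f - g"
  define k where "k = subdegree h"
  have "h \<noteq> 0" using \<open>f \<noteq> g\<close> by (simp add: h_def)
  have hk: "fps_nth h k \<noteq> 0" and below: "\<And>i. i < k \<Longrightarrow> fps_nth h i = 0"
    using \<open>h \<noteq> 0\<close> by (auto simp: k_def nth_subdegree_nonzero)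
  have "fps_nth h 0 = 0" "fps_nth h 1 = 0" using f0 g0 fg1 by (simp_all add: h_def)
  with hk have k2: "k \<ge> 2" by (metis One_nat_def less_2_cases not_le)
  have sum_sub: "subdegree (f + g) = 1"
    by (rule subdegreeI) (use f0 g0 fg1 g1 in auto)
  have "h * (f + g) = c * (h oo fps_X ^ 2)"
    using f g by (simp add: h_def fps_compose_sub_distrib algebra_simps power2_eq_square)
  moreover have "subdegree (h * (f + g)) = k + 1"
    using \<open>h \<noteq> 0\<close> sum_sub by (subst subdegree_mult) (auto simp: k_def)
  moreover have "h oo fps_X ^ 2 \<noteq> 0" "subdegree (h oo fps_X ^ 2) = 2 * k"
  proof -
    have "fps_nth (h oo fps_X ^ 2) (2 * k) \<noteq> 0" using hk by (simp add: fps_nth_compose_X_power)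
    then show "h oo fps_X ^ 2 \<noteq> 0" by auto
    show "subdegree (h oo fps_X ^ 2) = 2 * k"
      by (rule subdegreeI) (use hk below in \<open>auto simp: fps_nth_compose_X_power\<close>)
  qed
  moreover have "c \<noteq> 0" "subdegree c = 0" using c0 by auto
  ultimately have "k + 1 = 2 * k" by (metis subdegree_mult add_0)
  with k2 show False by simp
qed

text \<open>
  For the left side the recursion is the AGM computation
  \<open>(\<theta>\<^sub>3\<^sup>2 - \<theta>\<^sub>4\<^sup>2)\<^sup>2 = (\<theta>\<^sub>3\<^sup>2 + \<theta>\<^sub>4\<^sup>2)\<^sup>2 - 4 \<theta>\<^sub>3\<^sup>2 \<theta>\<^sub>4\<^sup>2 = 4 (\<theta>\<^sub>3(q\<^sup>2)^4 - \<theta>\<^sub>4(q\<^sup>2)^4)\<close>, where the last difference factors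
  and the sum of squares is again an arithmetic mean.  For the right side it is an identity
  between products, since \<open>G8 \<theta>\<^sub>4\<^sup>2 = q E(q^8)^4 / E(q^4)\<^sup>2\<close> with \<open>E\<close> the Euler product.
\<close>

lemma theta_difference: "theta3_fps ^ 2 - theta4_fps ^ 2 = 8 * G8 * theta4_fps ^ 2"
proof (rule fps_square_recursion_unique)
  let ?c = "8 * (theta3_fps oo fps_X ^ 4) ^ 2"
  show "(theta3_fps ^ 2 - theta4_fps ^ 2) ^ 2 = ?c * ((theta3_fps ^ 2 - theta4_fps ^ 2) oo fps_X ^ 2)"
  proof -
    have "(theta3_fps ^ 2 - theta4_fps ^ 2) oo fps_X ^ 2 =
        (theta3_fps oo fps_X ^ 2) ^ 2 - (theta4_fps oo fps_X ^ 2) ^ 2"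
      by (simp add: fps_compose_sub_distrib fps_compose_power)
    moreover have "(theta3_fps oo fps_X ^ 2) ^ 2 + (theta4_fps oo fps_X ^ 2) ^ 2 =
        2 * (theta3_fps oo fps_X ^ 4) ^ 2"
      using arg_cong[OF theta_arithmetic_mean, of "\<lambda>f. f oo fps_X ^ 2"]
      by (simp add: fps_compose_add_distrib fps_compose_mult_distrib fps_compose_power[symmetric]
          fps_oo_X_power_oo_X_power)
    ultimately show ?thesis
      using theta_arithmetic_mean theta_geometric_mean by algebra
  qed
  show "(8 * G8 * theta4_fps ^ 2) ^ 2 = ?c * ((8 * G8 * theta4_fps ^ 2) oo fps_X ^ 2)"
  proof -
    let ?p = "G8 * theta4_fps ^ 2"
    let ?e = "\<lambda>m. euler_fps oo fps_X ^ m"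
    have e_nz: "?e m \<noteq> 0" for m
      by (metis euler_fps_nth_0 fps_compose_nth_0 fps_zero_nth zero_neq_one)
    have "(?e 2) ^ 2 * (?p * ?e 4 ^ 2) = (?e 2) ^ 2 * (fps_X * ?e 8 ^ 4)"
      using G8_mult_euler_fps(1) gauss_theta4 by algebra
    then have p: "?p * ?e 4 ^ 2 = fps_X * ?e 8 ^ 4"
      using e_nz[of 2] by simp
    have p2: "(?p oo fps_X ^ 2) * ?e 8 ^ 2 = fps_X ^ 2 * ?e 16 ^ 4"
      using arg_cong[OF p, of "\<lambda>f. f oo fps_X ^ 2"]
      by (simp add: fps_compose_mult_distrib fps_compose_power[symmetric] fps_oo_X_power_oo_X_power)
    have t4: "(theta3_fps oo fps_X ^ 4) * ?e 4 ^ 2 * ?e 16 ^ 2 = ?e 8 ^ 5"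
      using arg_cong[OF theta3_euler_quotient, of "\<lambda>f. f oo fps_X ^ 4"]
      by (simp add: fps_compose_mult_distrib fps_compose_power[symmetric] fps_oo_X_power_oo_X_power)
    have "(?e 4 ^ 4 * ?e 16 ^ 4 * ?e 8 ^ 2) * ?p ^ 2 = fps_X ^ 2 * ?e 8 ^ 10 * ?e 16 ^ 4"
      using p by algebra
    also have "\<dots> = (?e 4 ^ 4 * ?e 16 ^ 4 * ?e 8 ^ 2) *
        ((theta3_fps oo fps_X ^ 4) ^ 2 * (?p oo fps_X ^ 2))"
      using p2 t4 by algebra
    finally have rec: "?p ^ 2 = (theta3_fps oo fps_X ^ 4) ^ 2 * (?p oo fps_X ^ 2)"
      using e_nz by simp
    have "(8 * G8 * theta4_fps ^ 2) oo fps_X ^ 2 = 8 * (?p oo fps_X ^ 2)"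
      by (simp add: mult.assoc fps_compose_mult_distrib)
    then show ?thesis
      using rec by algebra
  qed
  have "{k :: int. k ^ 2 = 1} = {1, -1}" by (auto simp: power2_eq_1_iff)
  then have "fps_nth theta3_fps 0 = 1" "fps_nth theta3_fps 1 = 2"
    by (simp_all add: theta3_fps_def)
  then show "fps_nth ?c 0 \<noteq> 0"
    "fps_nth (theta3_fps ^ 2 - theta4_fps ^ 2) 0 = 0"
    "fps_nth (8 * G8 * theta4_fps ^ 2) 0 = 0"
    "fps_nth (theta3_fps ^ 2 - theta4_fps ^ 2) 1 = fps_nth (8 * G8 * theta4_fps ^ 2) 1"
    "fps_nth (8 * G8 * theta4_fps ^ 2) 1 \<noteq> 0"
    using G8_mult_euler_fps(2,3)
    by (simp_all add: theta4_fps_def power2_eq_square fps_mult_nth fps_compose_uminus' numeral_fps_const)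
qed

theorem lemma3p6:
  shows "G8 ^ 2 =
    (8 * (G8 oo fps_X ^ 2) + 32 * (G8 oo fps_X ^ 2) ^ 2) * G8 +
    ((G8 oo fps_X ^ 2) + 4 * (G8 oo fps_X ^ 2) ^ 2)"
proof -
  let ?y = "G8 oo fps_X ^ 2"
  have nz: "theta4_fps \<noteq> 0"
    using gauss_theta4 by (metis euler_fps_nth_0 fps_nth_power_0 fps_zero_nth mult_zero_right power_one zero_neq_one)
  have "(theta3_fps ^ 2 - theta4_fps ^ 2) oo fps_X ^ 2 = (8 * G8 * theta4_fps ^ 2) oo fps_X ^ 2"
    by (simp only: theta_difference)
  then have "(theta3_fps oo fps_X ^ 2) ^ 2 - (theta4_fps oo fps_X ^ 2) ^ 2 = 8 * ?y * (theta4_fps oo fps_X ^ 2) ^ 2"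
    by (simp add: fps_compose_sub_distrib fps_compose_mult_distrib fps_compose_power)
  then have y: "16 * ?y * (theta3_fps * theta4_fps) = (theta3_fps - theta4_fps) ^ 2"
    using theta_arithmetic_mean theta_geometric_mean by algebra
  have "64 * theta4_fps ^ 2 * (?y * (1 + 4 * ?y) * theta3_fps ^ 2) = 64 * theta4_fps ^ 2 * (G8 ^ 2 * theta4_fps ^ 2)"
    using y theta_difference by algebra
  then have "?y * (1 + 4 * ?y) * theta3_fps ^ 2 = G8 ^ 2 * theta4_fps ^ 2"
    using nz by simp
  then have "theta4_fps ^ 2 * (?y * (1 + 4 * ?y) * (1 + 8 * G8)) = theta4_fps ^ 2 * G8 ^ 2"
    using theta_difference by algebra
  then have "?y * (1 + 4 * ?y) * (1 + 8 * G8) = G8 ^ 2"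
    using nz by simp
  then show ?thesis by algebra
qed

end
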